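(* In the smart-contract blockchain model (with either the DFS or the BFS execution order), the four mechanisms $\mathtt{trmem}$ (transaction memory), $\mathtt{first}$, $\mathtt{count}$ and $\mathtt{bstore}$ (bounded storage hookup) are pairwise equivalent; that is, each of them implements each of the others.
   Context: Blockchain model. A configuration is a pair $(\Sigma,\Delta)$: $\Sigma$ is a partial map from addresses to the storage ($st$) and balance of smart contracts, and $\Delta$ is a context with additional information (block number, time, etc.). An operation $o$ is a record with fields $dest$ (invoked address), $src$ (source address), $param$ (parameters) and $money$ (amount sent). A smart contract is a deterministic partial map $A:\Delta\times P\times S\times\mathbb{N}\rightharpoonup S\times[\mathcal{O}]$ taking context, parameters, current storage and balance to a new storage and a list of new operations; undefined means failure. A fixed partial map $\mathbb{G}$ assigns contracts to addresses. Executing $o$ from $(\Sigma,\Delta)$ succeeds iff the balance of $o.src$ is at least $o.money$ and $\mathbb{G}(o.dest)(\Delta,o.param,\Sigma(o.dest).st,\Sigma(o.dest).balance)=(st',ls)$ is defined; then $o.money$ is moved from $o.src$ to $o.dest$, the storage of $o.dest$ becomes $st'$, and the new operations $ls$ are emitted. A transaction starts with pending list $[o]$, $o$ an external operation, and repeatedly executes the head $o$ of the pending list $o::os$; the new pending list is $ls \mathbin{+\!\!+} os$ (DFS) or $os \mathbin{+\!\!+} ls$ (BFS). If an operation fails, the transaction fails and the state is unchanged; if the pending list becomes empty, the transaction commits. Gas consumption is disregarded: there is always sufficient gas for finite executions. Mechanisms. - $\mathtt{first}$: an instruction returning true iff the current operation is the first invocation of the executing contract in the current transaction. - $\mathtt{count}$: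 an instruction returning how many invocations to methods of the executing contract have been performed in the current transaction (before the current one, so it is $0$ at the first invocation). - $\mathtt{trmem}$: each contract has a volatile memory segment of a declared type that exists only during a transaction and is created and initialized at the beginning of the transaction by a declared procedure, which may read but not change the conventional storage. - $\mathtt{bstore}$: each contract may declare a method (hookup) that updates its storage after the last operation on that contract in the transaction; it can only modify the storage, cannot invoke other methods, and is restricted to terminating, non-failing functions. Implementation. A mechanism $M$ implements a mechanism $N$ iff a blockchain equipped with $M$ can write every smart contract that a blockchain equipped with $N$ can write; i.e. for each contract written using $N$ there is a contract written using $M$ (possibly with auxiliary storage fields) that can replace it, with the same transactions failing or committing and the same behaviour as observed in the executions of the contract's operations. Two mechanisms are equivalent iff each implements the other. *)

theory Defs
  imports Main "HOL-Library.Monad_Syntax"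
begin

section \<open>Blockchain model\<close>

text \<open>
  All stored data lives in one universe, generated from an arbitrary base type and closed under
  pairing, so that contracts with different storage types run on the same chain and every
  storage can be extended by an auxiliary component: \<open>Duo s x\<close> is the storage \<open>s\<close> together with
  the auxiliary fields \<open>x\<close>.
\<close>

datatype 'b data = Base 'b | Bool bool | Nat nat | Duo (main: "'b data") (aux: "'b data")

record ('a, 'p) operation =
  dest :: 'a
  src :: 'a
  param :: 'p
  money :: nat

record 'b account =
  st :: "'b data"
  balance :: nat

text \<open>External users also own accounts (to pay from); their storage is irrelevant.\<close>

type_synonym ('a, 'b) ledger = "'a \<Rightarrow> 'b account option"

text \<open>Context, parameters, storage and balance (before the transfer) are mapped to the new
  storage and the emitted operations; \<open>None\<close> is failure.\<close>

type_synonym ('a, 'p, 'c, 'b) code =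
  "'c \<Rightarrow> 'p \<Rightarrow> 'b data \<Rightarrow> nat \<Rightarrow> ('b data \<times> ('a, 'p) operation list) option"

text \<open>
  \<^item> \<open>Plain f\<close> uses no mechanism.
  \<^item> \<open>First f\<close> and \<open>Count f\<close>: the additional argument of \<open>f\<close> is the value returned by the
    instruction \<open>first\<close>, respectively \<open>count\<close>.
  \<^item> \<open>Trmem i f\<close>: \<open>i\<close> computes the initial contents of the transaction memory from the context
    and the storage; \<open>f\<close> takes the current transaction memory as additional argument and
    also returns its new contents.
  \<^item> \<open>Bstore h f\<close>: \<open>h\<close> is the hookup.
\<close>

datatype ('a, 'p, 'c, 'b) contract =
    Plain "('a, 'p, 'c, 'b) code"
  | First "bool \<Rightarrow> ('a, 'p, 'c, 'b) code"
  | Count "nat \<Rightarrow> ('a, 'p, 'c, 'b) code"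
  | Trmem "'c \<Rightarrow> 'b data \<Rightarrow> 'b data"
      "'b data \<Rightarrow> 'c \<Rightarrow> 'p \<Rightarrow> 'b data \<Rightarrow> nat \<Rightarrow>
        ('b data \<times> 'b data \<times> ('a, 'p) operation list) option"
  | Bstore "'c \<Rightarrow> 'b data \<Rightarrow> 'b data" "('a, 'p, 'c, 'b) code"

type_synonym ('a, 'p, 'c, 'b) network = "'a \<Rightarrow> ('a, 'p, 'c, 'b) contract option"

text \<open>The argument \<open>n\<close> is the number of previous invocations of the contract in the current
  transaction, \<open>v\<close> is its transaction memory (\<open>None\<close> if it declares none). The result consists
  of the new storage, the new transaction memory and the emitted operations.\<close>

fun invoke :: "('a, 'p, 'c, 'b) contract \<Rightarrow> nat \<Rightarrow> 'b data option \<Rightarrow> 'c \<Rightarrow> 'p \<Rightarrow> 'b data \<Rightarrow> nat \<Rightarrow>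
    ('b data \<times> 'b data option \<times> ('a, 'p) operation list) option" where
  "invoke (Plain f) n v \<Delta> p s b = map_option (\<lambda>(s', ls). (s', v, ls)) (f \<Delta> p s b)"
| "invoke (First f) n v \<Delta> p s b = map_option (\<lambda>(s', ls). (s', v, ls)) (f (n = 0) \<Delta> p s b)"
| "invoke (Count f) n v \<Delta> p s b = map_option (\<lambda>(s', ls). (s', v, ls)) (f n \<Delta> p s b)"
| "invoke (Trmem i f) n v \<Delta> p s b =
     do { m \<leftarrow> v; map_option (\<lambda>(s', m', ls). (s', Some m', ls)) (f m \<Delta> p s b) }"
| "invoke (Bstore h f) n v \<Delta> p s b = map_option (\<lambda>(s', ls). (s', v, ls)) (f \<Delta> p s b)"


section \<open>Transactions\<close>

record ('a, 'b) tx_state =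
  ledger :: "('a, 'b) ledger"
  invocations :: "'a \<Rightarrow> nat"
  trmem :: "'a \<Rightarrow> 'b data option"

definition tx_begin :: "('a, 'p, 'c, 'b) network \<Rightarrow> 'c \<Rightarrow> ('a, 'b) ledger \<Rightarrow> ('a, 'b) tx_state" where
  "tx_begin G \<Delta> \<Sigma> = \<lparr> ledger = \<Sigma>, invocations = (\<lambda>_. 0),
     trmem = (\<lambda>a. case G a of
         Some (Trmem i f) \<Rightarrow> map_option (\<lambda>acc. i \<Delta> (st acc)) (\<Sigma> a)
       | _ \<Rightarrow> None) \<rparr>"

definition transfer :: "'a \<Rightarrow> 'a \<Rightarrow> nat \<Rightarrow> ('a, 'b) ledger \<Rightarrow> ('a, 'b) ledger" where
  "transfer a b m \<Sigma> =
     (let \<Sigma>' = \<Sigma>(a := map_option (\<lambda>acc. acc\<lparr>balance := balance acc - m\<rparr>) (\<Sigma> a))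
      in \<Sigma>'(b := map_option (\<lambda>acc. acc\<lparr>balance := balance acc + m\<rparr>) (\<Sigma>' b)))"

definition store :: "'a \<Rightarrow> 'b data \<Rightarrow> ('a, 'b) ledger \<Rightarrow> ('a, 'b) ledger" where
  "store a s \<Sigma> = \<Sigma>(a := map_option (\<lambda>acc. acc\<lparr>st := s\<rparr>) (\<Sigma> a))"

definition execute :: "('a, 'p, 'c, 'b) network \<Rightarrow> 'c \<Rightarrow> ('a, 'p) operation \<Rightarrow> ('a, 'b) tx_state \<Rightarrow>
    (('a, 'b) tx_state \<times> ('a, 'p) operation list) option" where
  "execute G \<Delta> x \<tau> = do {
     payer \<leftarrow> ledger \<tau> (src x);
     callee \<leftarrow> ledger \<tau> (dest x);
     C \<leftarrow> G (dest x);
     if balance payer < money x then None else do {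
       (s', v', ls) \<leftarrow> invoke C (invocations \<tau> (dest x)) (trmem \<tau> (dest x))
                        \<Delta> (param x) (st callee) (balance callee);
       Some (\<lparr> ledger = store (dest x) s' (transfer (src x) (dest x) (money x) (ledger \<tau>)),
               invocations = (invocations \<tau>)(dest x := Suc (invocations \<tau> (dest x))),
               trmem = (trmem \<tau>)(dest x := v') \<rparr>, ls)
     }
   }"

text \<open>Hookups of the contracts invoked in the transaction are run when the pending list is
  empty. As the storage of a contract is accessed by operations on that contract only, this is
  the same as running each of them right after the last operation on its contract.\<close>

definition tx_end :: "('a, 'p, 'c, 'b) network \<Rightarrow> 'c \<Rightarrow> ('a, 'b) tx_state \<Rightarrow> ('a, 'b) ledger" where
  "tx_end G \<Delta> \<tau> = (\<lambda>a. case G a of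
       Some (Bstore h f) \<Rightarrow>
         if invocations \<tau> a > 0
         then map_option (\<lambda>acc. acc\<lparr>st := h \<Delta> (st acc)\<rparr>) (ledger \<tau> a)
         else ledger \<tau> a
     | _ \<Rightarrow> ledger \<tau> a)"

datatype order = DFS | BFS

fun enqueue :: "order \<Rightarrow> 'x list \<Rightarrow> 'x list \<Rightarrow> 'x list" where
  "enqueue DFS ls xs = ls @ xs"
| "enqueue BFS ls xs = xs @ ls"

text \<open>What is observed of an executed operation: the operation, the storage it leaves in the
  executing contract, the operations it emits, and all balances afterwards.\<close>

record ('a, 'p, 'b) event =
  executed :: "('a, 'p) operation"
  stored :: "'b data"
  emitted :: "('a, 'p) operation list"
  balances :: "'a \<Rightarrow> nat option"

definition event_of ::
    "('a, 'p) operation \<Rightarrow> ('a, 'b) tx_state \<Rightarrow> ('a, 'p) operation list \<Rightarrow> ('a, 'p, 'b) event" where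
  "event_of x \<tau>' ls = \<lparr> executed = x, stored = st (the (ledger \<tau>' (dest x))), emitted = ls,
     balances = (\<lambda>a. map_option balance (ledger \<tau>' a)) \<rparr>"

datatype status = Committed | Failed | Ongoing

text \<open>Execution of a pending list, with the events that occur and the final transaction state.
  \<open>Ongoing\<close> is derivable for every finite prefix of an execution, so that non-terminating
  executions are observed as well.\<close>

inductive run :: "order \<Rightarrow> ('a, 'p, 'c, 'b) network \<Rightarrow> 'c \<Rightarrow> ('a, 'b) tx_state \<Rightarrow> ('a, 'p) operation list \<Rightarrow>
    ('a, 'p, 'b) event list \<Rightarrow> status \<Rightarrow> ('a, 'b) tx_state \<Rightarrow> bool"
  for ord G \<Delta> where
  pause: "run ord G \<Delta> \<tau> xs [] Ongoing \<tau>"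
| commit: "run ord G \<Delta> \<tau> [] [] Committed \<tau>"
| abort: "execute G \<Delta> x \<tau> = None \<Longrightarrow> run ord G \<Delta> \<tau> (x # xs) [] Failed \<tau>"
| step: "execute G \<Delta> x \<tau> = Some (\<tau>', ls) \<Longrightarrow> run ord G \<Delta> \<tau>' (enqueue ord ls xs) es r \<tau>'' \<Longrightarrow>
    run ord G \<Delta> \<tau> (x # xs) (event_of x \<tau>' ls # es) r \<tau>''"

text \<open>Consecutive transactions, each given by its context and its external operation, executed
  from a ledger. The result lists the events and the status of each transaction.\<close>

inductive history :: "order \<Rightarrow> ('a, 'p, 'c, 'b) network \<Rightarrow> ('a, 'b) ledger \<Rightarrow>
    ('c \<times> ('a, 'p) operation) list \<Rightarrow> (('a, 'p, 'b) event list \<times> status) list \<Rightarrow> bool"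
  for ord G where
  empty: "history ord G \<Sigma> [] []"
| committed: "run ord G \<Delta> (tx_begin G \<Delta> \<Sigma>) [x] es Committed \<tau> \<Longrightarrow>
    history ord G (tx_end G \<Delta> \<tau>) txs obs \<Longrightarrow>
    history ord G \<Sigma> ((\<Delta>, x) # txs) ((es, Committed) # obs)"
| failed: "run ord G \<Delta> (tx_begin G \<Delta> \<Sigma>) [x] es Failed \<tau> \<Longrightarrow>
    history ord G \<Sigma> txs obs \<Longrightarrow>
    history ord G \<Sigma> ((\<Delta>, x) # txs) ((es, Failed) # obs)"
| ongoing: "run ord G \<Delta> (tx_begin G \<Delta> \<Sigma>) [x] es Ongoing \<tau> \<Longrightarrow>
    history ord G \<Sigma> [(\<Delta>, x)] [(es, Ongoing)]"


section \<open>Mechanisms and implementation\<close>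

text \<open>A mechanism is given by the contracts that can be written on a blockchain equipped
  with it.\<close>

type_synonym ('a, 'p, 'c, 'b) mechanism = "('a, 'p, 'c, 'b) contract set"

definition first_mech :: "('a, 'p, 'c, 'b) mechanism" where
  "first_mech = range Plain \<union> range First"

definition count_mech :: "('a, 'p, 'c, 'b) mechanism" where
  "count_mech = range Plain \<union> range Count"

definition trmem_mech :: "('a, 'p, 'c, 'b) mechanism" where
  "trmem_mech = range Plain \<union> {Trmem i f | i f. True}"

definition bstore_mech :: "('a, 'p, 'c, 'b) mechanism" where
  "bstore_mech = range Plain \<union> {Bstore h f | h f. True}"

text \<open>Replacing the contracts at the addresses \<open>D\<close>. A contract \<open>C\<close> is replaced by \<open>tr C\<close>, whose
  storage consists of the storage of \<open>C\<close> and auxiliary fields with initial value \<open>ini C\<close>.\<close>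

definition replace_contracts :: "(('a, 'p, 'c, 'b) contract \<Rightarrow> ('a, 'p, 'c, 'b) contract) \<Rightarrow>
    'a set \<Rightarrow> ('a, 'p, 'c, 'b) network \<Rightarrow> ('a, 'p, 'c, 'b) network" where
  "replace_contracts tr D G = (\<lambda>a. if a \<in> D then map_option tr (G a) else G a)"

definition add_fields :: "(('a, 'p, 'c, 'b) contract \<Rightarrow> 'b data) \<Rightarrow>
    'a set \<Rightarrow> ('a, 'p, 'c, 'b) network \<Rightarrow> ('a, 'b) ledger \<Rightarrow> ('a, 'b) ledger" where
  "add_fields ini D G \<Sigma> = (\<lambda>a.
     if a \<in> D then map_option (\<lambda>acc. acc\<lparr>st := Duo (st acc) (ini (the (G a)))\<rparr>) (\<Sigma> a) else \<Sigma> a)"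

definition hide_fields :: "'a set \<Rightarrow> ('a, 'p, 'b) event \<Rightarrow> ('a, 'p, 'b) event" where
  "hide_fields D e = (if dest (executed e) \<in> D then e\<lparr>stored := main (stored e)\<rparr> else e)"

text \<open>The map \<open>tr\<close> assigns to each contract of \<open>N\<close> its replacement written with \<open>M\<close>. The set \<open>D\<close>
  may be a single address, in an arbitrary environment, or the whole domain of \<open>G\<close>, in which
  case an entire blockchain equipped with \<open>N\<close> becomes one equipped with \<open>M\<close>.\<close>

definition implements ::
    "order \<Rightarrow> ('a, 'p, 'c, 'b) mechanism \<Rightarrow> ('a, 'p, 'c, 'b) mechanism \<Rightarrow> bool" where
  "implements ord M N \<longleftrightarrow> (\<exists>tr ini. (\<forall>C\<in>N. tr C \<in> M) \<and>
     (\<forall>G D \<Sigma>. (\<forall>a\<in>D. \<exists>C\<in>N. G a = Some C) \<longrightarrow>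
       (\<forall>txs obs. history ord G \<Sigma> txs obs \<longleftrightarrow>
         (\<exists>obs'. history ord (replace_contracts tr D G) (add_fields ini D G \<Sigma>) txs obs' \<and>
                 obs = map (map_prod (map (hide_fields D)) id) obs'))))"

definition mech_equivalent ::
    "order \<Rightarrow> ('a, 'p, 'c, 'b) mechanism \<Rightarrow> ('a, 'p, 'c, 'b) mechanism \<Rightarrow> bool" where
  "mech_equivalent ord M N \<longleftrightarrow> implements ord M N \<and> implements ord N M"

end

theory Submission
  imports Defs
begin

text \<open>
  Every mechanism allows a contract to recognise the first operation of a transaction, and this
  suffices to interpret an arbitrary contract. All volatile information about the interpreted
  contract (number of invocations, transaction memory) is kept in the auxiliary fields and
  discarded at the first operation of the next transaction. A hookup is simulated ahead of time:
  each operation additionally saves the storage that the hookup would produce, since the context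
  needed to compute it is gone when the next transaction begins; the first operation of that
  transaction then resumes from the saved storage.
\<close>

section \<open>Memory initialisation and hookups, uniformly for all kinds of contracts\<close>

fun initial_memory :: "('a, 'p, 'c, 'b) contract \<Rightarrow> 'c \<Rightarrow> 'b data \<Rightarrow> 'b data option" where
  "initial_memory (Trmem i f) \<Delta> s = Some (i \<Delta> s)"
| "initial_memory _ \<Delta> s = None"

fun hookup :: "('a, 'p, 'c, 'b) contract \<Rightarrow> 'c \<Rightarrow> 'b data \<Rightarrow> 'b data" where
  "hookup (Bstore h f) \<Delta> s = h \<Delta> s"
| "hookup _ \<Delta> s = s"

lemma trmem_tx_begin:
  "trmem (tx_begin G \<Delta> \<Sigma>) a =
     (case G a of None \<Rightarrow> None | Some C \<Rightarrow> Option.bind (\<Sigma> a) (\<lambda>acc. initial_memory C \<Delta> (st acc)))"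
  by (cases "\<Sigma> a") (auto simp: tx_begin_def split: option.splits contract.splits)

lemma tx_end_hookup:
  "tx_end G \<Delta> \<tau> a =
     (case G a of None \<Rightarrow> ledger \<tau> a | Some C \<Rightarrow>
        if invocations \<tau> a = 0 then ledger \<tau> a
        else map_option (\<lambda>acc. acc\<lparr>st := hookup C \<Delta> (st acc)\<rparr>) (ledger \<tau> a))"
  by (auto simp: tx_end_def option.map_ident split: option.splits contract.splits)


section \<open>Interpreting arbitrary contracts\<close>

text \<open>The outermost constructor is the tag, so that a memory with contents
  \<open>Bool False\<close> stays distinct from an absent one.\<close>

fun encode_memory :: "'b data option \<Rightarrow> 'b data" where
  "encode_memory None = Bool False"
| "encode_memory (Some m) = Duo m m"

fun decode_memory :: "'b data \<Rightarrow> 'b data option" where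
  "decode_memory (Duo m _) = Some m"
| "decode_memory _ = None"

lemma decode_encode_memory [simp]: "decode_memory (encode_memory v) = v"
  by (cases v) auto

text \<open>The interpreted storage has to be the \<open>main\<close> component, because that is
  what \<open>hide_fields\<close> exposes. The auxiliary part is always a \<open>Duo\<close>, which
  keeps it apart from the marker \<open>Bool False\<close>.\<close>

definition pack :: "('a, 'p, 'c, 'b) contract \<Rightarrow> 'c \<Rightarrow> nat \<Rightarrow> 'b data option \<Rightarrow> 'b data \<Rightarrow> 'b data" where
  "pack C \<Delta> n v s = Duo s (Duo (Duo (Nat n) (encode_memory v)) (hookup C \<Delta> s))"

text \<open>The auxiliary value \<open>Bool False\<close> marks a contract that has not been invoked since its
  deployment (or, for \<open>Bstore\<close>, in the current transaction).\<close>

definition resume :: "'b data \<Rightarrow> 'b data" where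
  "resume u = (if aux u = Bool False then main u else aux (aux u))"

definition unpack_count :: "'b data \<Rightarrow> nat" where
  "unpack_count u = (case main (aux u) of Duo (Nat n) _ \<Rightarrow> n | _ \<Rightarrow> 0)"

definition unpack_memory :: "'b data \<Rightarrow> 'b data option" where
  "unpack_memory u = decode_memory (aux (main (aux u)))"

lemma pack_simps [simp]:
  "main (pack C \<Delta> n v s) = s"
  "aux (pack C \<Delta> n v s) \<noteq> Bool False"
  "resume (pack C \<Delta> n v s) = hookup C \<Delta> s"
  "aux (aux (pack C \<Delta> n v s)) = hookup C \<Delta> s"
  "unpack_count (pack C \<Delta> n v s) = n"
  "unpack_memory (pack C \<Delta> n v s) = v"
  by (simp_all add: pack_def resume_def unpack_count_def unpack_memory_def)

text \<open>The flag \<open>is_first\<close> is all that the host mechanism has to supply. The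
  simulated transaction memory is initialised at the first operation instead of at the beginning of
  the transaction; the result is the same, since no operation has touched the storage of the
  contract in between.\<close>

definition interpret_contract ::
    "('a, 'p, 'c, 'b) contract \<Rightarrow> bool \<Rightarrow> ('a, 'p, 'c, 'b) code" where
  "interpret_contract C is_first \<Delta> p u b =
     (let s = if is_first then resume u else main u;
          n = if is_first then 0 else unpack_count u;
          v = if is_first then initial_memory C \<Delta> s else unpack_memory u
      in map_option (\<lambda>(s', v', ls). (pack C \<Delta> (Suc n) v' s', ls)) (invoke C n v \<Delta> p s b))"

text \<open>In the following locale, \<open>idle s u\<close> relates the storage \<open>s\<close> of a contract between two
  transactions (as seen by its next operation) to the storage \<open>u\<close> of its interpreter, and \<open>m\<close> is
  the transaction memory of the interpreter after its first operation.\<close>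

locale interpreter =
  fixes tr :: "('a, 'p, 'c, 'b) contract \<Rightarrow> ('a, 'p, 'c, 'b) contract"
    and idle :: "'b data \<Rightarrow> 'b data \<Rightarrow> bool"
    and m :: "'b data option"
  assumes idle_deployed: "idle s (Duo s (Bool False))"
    and idle_hookup: "idle (hookup C \<Delta> s) (hookup (tr C) \<Delta> (pack C \<Delta> n v s))"
    and invoke_first: "idle s u \<Longrightarrow>
      invoke (tr C) 0 (initial_memory (tr C) \<Delta> u) \<Delta> p u b =
      map_option (\<lambda>(s', v', ls). (pack C \<Delta> 1 v' s', m, ls))
        (invoke C 0 (initial_memory C \<Delta> s) \<Delta> p s b)"
    and invoke_later: "n > 0 \<Longrightarrow>
      invoke (tr C) n m \<Delta> p (pack C \<Delta> n v s) b =
      map_option (\<lambda>(s', v', ls). (pack C \<Delta> (Suc n) v' s', m, ls)) (invoke C n v \<Delta> p s b)"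


section \<open>Simulation\<close>

locale replacement = interpreter tr idle m
  for tr :: "('a, 'p, 'c, 'b) contract \<Rightarrow> ('a, 'p, 'c, 'b) contract"
    and idle :: "'b data \<Rightarrow> 'b data \<Rightarrow> bool"
    and m :: "'b data option" +
  fixes G :: "('a, 'p, 'c, 'b) network" and D :: "'a set"
  assumes deployed: "a \<in> D \<Longrightarrow> G a \<noteq> None"
begin

abbreviation G' :: "('a, 'p, 'c, 'b) network" where
  "G' \<equiv> replace_contracts tr D G"

lemma G'_in: "a \<in> D \<Longrightarrow> G a = Some C \<Longrightarrow> G' a = Some (tr C)"
  and G'_out: "a \<notin> D \<Longrightarrow> G' a = G a"
  by (simp_all add: replace_contracts_def)

section \<open>Simulation relations\<close>

definition ledger_sim :: "('a, 'b) ledger \<Rightarrow> ('a, 'b) ledger \<Rightarrow> bool" where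
  "ledger_sim \<Sigma> \<Sigma>' \<longleftrightarrow> (\<forall>a. if a \<in> D
     then rel_option (\<lambda>acc acc'. balance acc = balance acc' \<and> idle (st acc) (st acc')) (\<Sigma> a) (\<Sigma>' a)
     else \<Sigma> a = \<Sigma>' a)"

text \<open>Before its first invocation in a transaction, the interpreter may still hold the counter
  and memory of an earlier one, so only \<open>idle\<close> can be demanded. Afterwards its storage
  is determined exactly. The context is fixed during a transaction, hence the hookup result saved by
  \<open>pack\<close> is the one that \<open>tx_end\<close> computes.\<close>

definition storage_sim :: "('a, 'p, 'c, 'b) contract \<Rightarrow> 'c \<Rightarrow> nat \<Rightarrow> 'b data option \<Rightarrow> 'b data option \<Rightarrow>
    'b data \<Rightarrow> 'b data \<Rightarrow> bool" where
  "storage_sim C \<Delta> n v v' s u \<longleftrightarrow>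
     (if n = 0 then idle s u \<and> v = initial_memory C \<Delta> s \<and> v' = initial_memory (tr C) \<Delta> u
      else u = pack C \<Delta> n v s \<and> v' = m)"

text \<open>Relating the values at one address, not whole states, makes the relation applicable to
  the intermediate ledger of a transfer.\<close>

definition account_sim :: "'c \<Rightarrow> 'a \<Rightarrow> nat \<Rightarrow> 'b data option \<Rightarrow> 'b data option \<Rightarrow>
    'b account option \<Rightarrow> 'b account option \<Rightarrow> bool" where
  "account_sim \<Delta> a n v v' A A' \<longleftrightarrow> (if a \<in> D
     then rel_option (\<lambda>acc acc'. balance acc = balance acc' \<and>
            storage_sim (the (G a)) \<Delta> n v v' (st acc) (st acc')) A A'
     else A = A' \<and> v = v')"

definition sim :: "'c \<Rightarrow> ('a, 'b) tx_state \<Rightarrow> ('a, 'b) tx_state \<Rightarrow> bool" where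
  "sim \<Delta> \<tau> \<tau>' \<longleftrightarrow> invocations \<tau>' = invocations \<tau> \<and>
     (\<forall>a. account_sim \<Delta> a (invocations \<tau> a) (trmem \<tau> a) (trmem \<tau>' a) (ledger \<tau> a) (ledger \<tau>' a))"

section \<open>Simulation of a single operation\<close>

lemma account_sim_balance:
  "account_sim \<Delta> a n v v' A A' \<Longrightarrow> map_option balance A' = map_option balance A"
  by (cases A; cases A') (auto simp: account_sim_def split: if_splits)

lemma account_sim_None_iff:
  "account_sim \<Delta> a n v v' A A' \<Longrightarrow> A' = None \<longleftrightarrow> A = None"
  by (cases A; cases A') (auto simp: account_sim_def split: if_splits)

lemma account_sim_update_balance:
  assumes "account_sim \<Delta> a n v v' A A'"
  shows "account_sim \<Delta> a n v v' (map_option (\<lambda>acc. acc\<lparr>balance := f (balance acc)\<rparr>) A)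
    (map_option (\<lambda>acc. acc\<lparr>balance := f (balance acc)\<rparr>) A')"
  using assms by (cases A; cases A') (auto simp: account_sim_def split: if_splits)

lemma sim_transfer:
  assumes "\<And>a. account_sim \<Delta> a (n a) (v a) (v' a) (\<Sigma> a) (\<Sigma>' a)"
  shows "account_sim \<Delta> a (n a) (v a) (v' a) (transfer x y k \<Sigma> a) (transfer x y k \<Sigma>' a)"
proof -
  \<comment> \<open>These are the ledgers after the debit alone. Payer and recipient may coincide,
    so the credit must be applied to them and not to the original ledgers.\<close>
  define \<Sigma>1 where "\<Sigma>1 = \<Sigma>(x := map_option (\<lambda>acc. acc\<lparr>balance := balance acc - k\<rparr>) (\<Sigma> x))"
  define \<Sigma>1' where "\<Sigma>1' = \<Sigma>'(x := map_option (\<lambda>acc. acc\<lparr>balance := balance acc - k\<rparr>) (\<Sigma>' x))"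
  have "account_sim \<Delta> a (n a) (v a) (v' a) (\<Sigma>1 a) (\<Sigma>1' a)" for a
    using assms account_sim_update_balance[OF assms, where f="\<lambda>b. b - k"]
    by (simp add: \<Sigma>1_def \<Sigma>1'_def)
  with account_sim_update_balance[OF this, where f="\<lambda>b. b + k"] show ?thesis
    unfolding transfer_def Let_def \<Sigma>1_def[symmetric] \<Sigma>1'_def[symmetric] by simp
qed

text \<open>The two branches of \<open>storage_sim\<close> are the situations covered by
  \<open>invoke_first\<close> and \<open>invoke_later\<close>.\<close>

lemma invoke_sim:
  assumes "a \<in> D" "storage_sim (the (G a)) \<Delta> n v v' s u" "G a = Some C"
  shows "invoke (tr C) n v' \<Delta> p u b =
    map_option (\<lambda>(s1, v1, ls). (pack C \<Delta> (Suc n) v1 s1, m, ls)) (invoke C n v \<Delta> p s b)"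
  using assms invoke_first[of s u C \<Delta> p b] invoke_later[of n C \<Delta> p v s b]
  by (auto simp: storage_sim_def split: if_splits)

text \<open>The counter of the callee becomes a successor, which puts it into the packed branch of
  \<open>storage_sim\<close>. Every other address sees at most a change of balance. The second
  conclusion is what \<open>hide_event_of\<close> needs to match the events.\<close>

lemma sim_update:
  fixes x :: 'a and k :: nat
  assumes sim: "sim \<Delta> \<tau> \<tau>'"
    and y: "ledger \<tau> y \<noteq> None"
    and upd: "if y \<in> D then u1 = pack (the (G y)) \<Delta> (Suc (invocations \<tau> y)) v1 s1 \<and> v1' = m
      else u1 = s1 \<and> v1' = v1"
  defines "\<tau>1 \<equiv> \<lparr>ledger = store y s1 (transfer x y k (ledger \<tau>)),
      invocations = (invocations \<tau>)(y := Suc (invocations \<tau> y)), trmem = (trmem \<tau>)(y := v1)\<rparr>"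
    and "\<tau>1' \<equiv> \<lparr>ledger = store y u1 (transfer x y k (ledger \<tau>')),
      invocations = (invocations \<tau>')(y := Suc (invocations \<tau>' y)), trmem = (trmem \<tau>')(y := v1')\<rparr>"
  shows "sim \<Delta> \<tau>1 \<tau>1'"
    and "st (the (ledger \<tau>1 y)) = (if y \<in> D then main (st (the (ledger \<tau>1' y)))
           else st (the (ledger \<tau>1' y)))"
proof -
  have *: "account_sim \<Delta> a (invocations \<tau> a) (trmem \<tau> a) (trmem \<tau>' a)
      (transfer x y k (ledger \<tau>) a) (transfer x y k (ledger \<tau>') a)" for a
    using sim_transfer[of \<Delta> "invocations \<tau>" "trmem \<tau>" "trmem \<tau>'" "ledger \<tau>" "ledger \<tau>'"] sim
    by (simp add: sim_def)
  obtain acc where acc: "transfer x y k (ledger \<tau>) y = Some acc"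
    using y by (cases "y = x") (auto simp: transfer_def Let_def)
  obtain acc' where acc': "transfer x y k (ledger \<tau>') y = Some acc'"
    using account_sim_None_iff[OF *[of y]] acc by auto
  show "sim \<Delta> \<tau>1 \<tau>1'"
    unfolding sim_def
  proof (intro conjI allI)
    show "invocations \<tau>1' = invocations \<tau>1"
      using sim by (simp add: sim_def \<tau>1_def \<tau>1'_def)
    fix a
    show "account_sim \<Delta> a (invocations \<tau>1 a) (trmem \<tau>1 a) (trmem \<tau>1' a) (ledger \<tau>1 a) (ledger \<tau>1' a)"
    proof (cases "a = y")
      case True
      then show ?thesis
        using *[of a] acc acc' upd
        by (auto simp: \<tau>1_def \<tau>1'_def store_def account_sim_def storage_sim_def split: if_splits)
    next
      case False
      then show ?thesis
        using *[of a] by (simp add: \<tau>1_def \<tau>1'_def store_def)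
    qed
  qed
  show "st (the (ledger \<tau>1 y)) = (if y \<in> D then main (st (the (ledger \<tau>1' y)))
           else st (the (ledger \<tau>1' y)))"
    using acc acc' upd by (auto simp: \<tau>1_def \<tau>1'_def store_def)
qed

lemma hide_event_of:
  assumes "sim \<Delta> \<tau> \<tau>'"
    and "st (the (ledger \<tau> (dest x))) = (if dest x \<in> D then main (st (the (ledger \<tau>' (dest x))))
           else st (the (ledger \<tau>' (dest x))))"
  shows "hide_fields D (event_of x \<tau>' ls) = event_of x \<tau> ls"
proof -
  have "map_option balance (ledger \<tau>' a) = map_option balance (ledger \<tau> a)" for a
    using assms(1) account_sim_balance unfolding sim_def by blast
  then show ?thesis
    using assms(2) by (auto simp: hide_fields_def event_of_def)
qed

text \<open>Using \<open>rel_option\<close> makes failures correspond as well as successes, so one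
  lemma serves both directions of the simulation.\<close>

lemma execute_sim:
  assumes sim: "sim \<Delta> \<tau> \<tau>'"
  shows "rel_option (\<lambda>(\<tau>1, ls) (\<tau>1', ls'). sim \<Delta> \<tau>1 \<tau>1' \<and> ls' = ls \<and>
           hide_fields D (event_of x \<tau>1' ls') = event_of x \<tau>1 ls)
         (execute G \<Delta> x \<tau>) (execute G' \<Delta> x \<tau>')"
proof -
  let ?y = "dest x"
  have accs: "account_sim \<Delta> a (invocations \<tau> a) (trmem \<tau> a) (trmem \<tau>' a) (ledger \<tau> a) (ledger \<tau>' a)"
    for a using sim by (simp add: sim_def)
  have inv: "invocations \<tau>' = invocations \<tau>"
    using sim by (simp add: sim_def)
  have G': "G' ?y = None \<longleftrightarrow> G ?y = None"
    by (simp add: replace_contracts_def)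
  show ?thesis
  proof (cases "ledger \<tau> (src x) = None \<or> ledger \<tau> ?y = None \<or> G ?y = None")
    case True
    then have "execute G \<Delta> x \<tau> = None"
      by (auto simp: execute_def Option.bind_eq_None_conv)
    moreover have "execute G' \<Delta> x \<tau>' = None"
      using True G' account_sim_None_iff[OF accs[of "src x"]] account_sim_None_iff[OF accs[of ?y]]
      by (cases "ledger \<tau>' (src x)"; cases "ledger \<tau>' ?y") (auto simp: execute_def)
    ultimately show ?thesis by simp
  next
    case False
    then obtain payer callee C where
      p: "ledger \<tau> (src x) = Some payer" "ledger \<tau> ?y = Some callee" "G ?y = Some C" by auto
    obtain payer' callee' where
      p': "ledger \<tau>' (src x) = Some payer'" "ledger \<tau>' ?y = Some callee'"
      using p account_sim_None_iff[OF accs[of "src x"]] account_sim_None_iff[OF accs[of ?y]] by auto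
    have bal: "balance payer' = balance payer" "balance callee' = balance callee"
      using account_sim_balance[OF accs[of "src x"]] account_sim_balance[OF accs[of ?y]] p p' by auto
    \<comment> \<open>One transformation of results covers both a replaced callee and one outside
      \<open>D\<close>, so that the rest of the argument needs no case distinction on how the callee
      was invoked.\<close>
    define w where "w = (if ?y \<in> D
        then (\<lambda>(s1, v1, ls :: ('a, 'p) operation list).
               (pack C \<Delta> (Suc (invocations \<tau> ?y)) v1 s1, m, ls))
        else id)"
    obtain C' where C': "G' ?y = Some C'"
      and invoke: "invoke C' (invocations \<tau> ?y) (trmem \<tau>' ?y) \<Delta> (param x) (st callee') (balance callee)
      = map_option w
          (invoke C (invocations \<tau> ?y) (trmem \<tau> ?y) \<Delta> (param x) (st callee) (balance callee))"
    proof (cases "?y \<in> D")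
      case True
      with p p' accs[of ?y] have "storage_sim (the (G ?y)) \<Delta> (invocations \<tau> ?y) (trmem \<tau> ?y)
          (trmem \<tau>' ?y) (st callee) (st callee')"
        by (simp add: account_sim_def)
      from that[of "tr C"] invoke_sim[OF True this p(3)] True p(3) show thesis
        by (simp add: w_def G'_in)
    next
      case False
      with p p' accs[of ?y] show thesis
        using that[of C] by (simp add: account_sim_def w_def G'_out option.map_id)
    qed
    show ?thesis
    proof (cases "balance payer < money x \<or>
        invoke C (invocations \<tau> ?y) (trmem \<tau> ?y) \<Delta> (param x) (st callee) (balance callee) = None")
      case True
      then show ?thesis
        using p p' bal inv invoke C' by (auto simp: execute_def)
    next
      case False
      then obtain s1 v1 ls where
        r: "invoke C (invocations \<tau> ?y) (trmem \<tau> ?y) \<Delta> (param x) (st callee) (balance callee)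
            = Some (s1, v1, ls)" by auto
      obtain u1 v1' where w: "w (s1, v1, ls) = (u1, v1', ls)"
        by (cases "?y \<in> D") (auto simp: w_def)
      have upd: "if ?y \<in> D then u1 = pack (the (G ?y)) \<Delta> (Suc (invocations \<tau> ?y)) v1 s1 \<and> v1' = m
          else u1 = s1 \<and> v1' = v1"
        using w p by (auto simp: w_def)
      note upd' = sim_update[OF sim _ upd, of "src x" "money x"]
      show ?thesis
        using False r w p p' bal inv invoke C' upd' hide_event_of[OF upd'(1) upd'(2)]
        by (simp add: execute_def)
    qed
  qed
qed

lemma execute_sim_cases:
  assumes "sim \<Delta> \<tau> \<tau>'"
  obtains "execute G \<Delta> x \<tau> = None" "execute G' \<Delta> x \<tau>' = None"
  | \<tau>1 \<tau>1' ls where "execute G \<Delta> x \<tau> = Some (\<tau>1, ls)" "execute G' \<Delta> x \<tau>' = Some (\<tau>1', ls)"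
    "sim \<Delta> \<tau>1 \<tau>1'" "hide_fields D (event_of x \<tau>1' ls) = event_of x \<tau>1 ls"
  using execute_sim[OF assms, of x]
  by (cases "execute G \<Delta> x \<tau>"; cases "execute G' \<Delta> x \<tau>'") auto

section \<open>Runs of a pending list\<close>

lemma run_sim:
  assumes "run ord G \<Delta> \<tau> xs es r \<tau>2" "sim \<Delta> \<tau> \<tau>'"
  shows "\<exists>es' \<tau>2'. run ord G' \<Delta> \<tau>' xs es' r \<tau>2' \<and> sim \<Delta> \<tau>2 \<tau>2' \<and> es = map (hide_fields D) es'"
  using assms
proof (induction arbitrary: \<tau>' rule: run.induct)
  case (abort x \<tau> xs)
  then have "execute G' \<Delta> x \<tau>' = None"
    using execute_sim_cases[OF abort.prems, of x] by auto
  with abort.prems show ?case by (auto intro: run.abort)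
next
  case (step x \<tau> \<tau>1 ls xs es r \<tau>2)
  obtain \<tau>1' where *: "execute G' \<Delta> x \<tau>' = Some (\<tau>1', ls)" "sim \<Delta> \<tau>1 \<tau>1'"
    "hide_fields D (event_of x \<tau>1' ls) = event_of x \<tau>1 ls"
    using execute_sim_cases[OF step.prems, of x] step.hyps(1) by auto
  \<comment> \<open>The emitted operations agree, so both sides continue with the same pending list
    under either execution order.\<close>
  obtain es' \<tau>2' where "run ord G' \<Delta> \<tau>1' (enqueue ord ls xs) es' r \<tau>2'" "sim \<Delta> \<tau>2 \<tau>2'"
    "es = map (hide_fields D) es'"
    using step.IH[OF *(2)] by blast
  with * show ?case
    by (intro exI[of _ "event_of x \<tau>1' ls # es'"] exI[of _ \<tau>2']) (auto intro: run.step)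
qed (auto intro: run.intros)

lemma run_sim_converse:
  assumes "run ord G' \<Delta> \<tau>' xs es' r \<tau>2'" "sim \<Delta> \<tau> \<tau>'"
  shows "\<exists>\<tau>2. run ord G \<Delta> \<tau> xs (map (hide_fields D) es') r \<tau>2 \<and> sim \<Delta> \<tau>2 \<tau>2'"
  using assms
proof (induction arbitrary: \<tau> rule: run.induct)
  case (abort x \<tau>' xs)
  then have "execute G \<Delta> x \<tau> = None"
    using execute_sim_cases[OF abort.prems, of x] by auto
  with abort.prems show ?case by (auto intro: run.abort)
next
  case (step x \<tau>' \<tau>1' ls xs es r \<tau>2')
  obtain \<tau>1 where *: "execute G \<Delta> x \<tau> = Some (\<tau>1, ls)" "sim \<Delta> \<tau>1 \<tau>1'"
    "hide_fields D (event_of x \<tau>1' ls) = event_of x \<tau>1 ls"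
    using execute_sim_cases[OF step.prems, of x] step.hyps(1) by auto
  obtain \<tau>2 where "run ord G \<Delta> \<tau>1 (enqueue ord ls xs) (map (hide_fields D) es) r \<tau>2"
    "sim \<Delta> \<tau>2 \<tau>2'"
    using step.IH[OF *(2)] by blast
  with * show ?case by (intro exI[of _ \<tau>2]) (auto intro: run.step)
qed (auto intro: run.intros)

section \<open>Transaction boundaries\<close>

lemma sim_tx_begin:
  assumes "ledger_sim \<Sigma> \<Sigma>'"
  shows "sim \<Delta> (tx_begin G \<Delta> \<Sigma>) (tx_begin G' \<Delta> \<Sigma>')"
  unfolding sim_def
proof (intro conjI allI)
  show "invocations (tx_begin G' \<Delta> \<Sigma>') = invocations (tx_begin G \<Delta> \<Sigma>)"
    by (simp add: tx_begin_def)
  fix a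
  have [simp]: "invocations (tx_begin G \<Delta> \<Sigma>) a = 0" "ledger (tx_begin G \<Delta> \<Sigma>) = \<Sigma>"
    "ledger (tx_begin G' \<Delta> \<Sigma>') = \<Sigma>'"
    by (simp_all add: tx_begin_def)
  \<comment> \<open>All counters are 0, so on \<open>D\<close> the relation asks for
    \<open>idle\<close> storages, given by \<open>ledger_sim\<close>, and for freshly initialised
    memories.\<close>
  show "account_sim \<Delta> a (invocations (tx_begin G \<Delta> \<Sigma>) a) (trmem (tx_begin G \<Delta> \<Sigma>) a)
      (trmem (tx_begin G' \<Delta> \<Sigma>') a) (ledger (tx_begin G \<Delta> \<Sigma>) a) (ledger (tx_begin G' \<Delta> \<Sigma>') a)"
  proof (cases "a \<in> D")
    case True
    with deployed obtain C where "G a = Some C" by blast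
    with True assms[unfolded ledger_sim_def, rule_format, of a] show ?thesis
      by (cases "\<Sigma> a"; cases "\<Sigma>' a")
        (auto simp: account_sim_def storage_sim_def trmem_tx_begin G'_in)
  next
    case False
    with assms[unfolded ledger_sim_def, rule_format, of a] show ?thesis
      by (simp add: account_sim_def trmem_tx_begin G'_out split: option.split)
  qed
qed

text \<open>For an address in \<open>D\<close> that was not invoked, no hookup runs and
  \<open>idle\<close> simply persists. For an invoked one, \<open>idle_hookup\<close> applies to the
  packed storage.\<close>

lemma ledger_sim_tx_end:
  assumes "sim \<Delta> \<tau> \<tau>'"
  shows "ledger_sim (tx_end G \<Delta> \<tau>) (tx_end G' \<Delta> \<tau>')"
  unfolding ledger_sim_def
proof
  fix a
  have inv: "invocations \<tau>' = invocations \<tau>"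
    and acc: "account_sim \<Delta> a (invocations \<tau> a) (trmem \<tau> a) (trmem \<tau>' a) (ledger \<tau> a) (ledger \<tau>' a)"
    using assms by (simp_all add: sim_def)
  show "if a \<in> D
     then rel_option (\<lambda>acc acc'. balance acc = balance acc' \<and> idle (st acc) (st acc'))
       (tx_end G \<Delta> \<tau> a) (tx_end G' \<Delta> \<tau>' a)
     else tx_end G \<Delta> \<tau> a = tx_end G' \<Delta> \<tau>' a"
  proof (cases "a \<in> D")
    case True
    with deployed obtain C where "G a = Some C" by blast
    with True acc inv show ?thesis
      by (cases "ledger \<tau> a"; cases "ledger \<tau>' a")
        (auto simp: account_sim_def storage_sim_def tx_end_hookup G'_in idle_hookup)
  next
    case False
    with acc inv show ?thesis
      by (simp add: account_sim_def tx_end_hookup G'_out split: option.split)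
  qed
qed

section \<open>Histories\<close>

lemma history_sim:
  assumes "history ord G \<Sigma> txs obs" "ledger_sim \<Sigma> \<Sigma>'"
  shows "\<exists>obs'. history ord G' \<Sigma>' txs obs' \<and> obs = map (map_prod (map (hide_fields D)) id) obs'"
  using assms
proof (induction arbitrary: \<Sigma>' rule: history.induct)
  case (empty \<Sigma>)
  then show ?case by (auto intro: history.empty)
next
  case (committed \<Delta> \<Sigma> x es \<tau> txs obs)
  obtain es' \<tau>' where run: "run ord G' \<Delta> (tx_begin G' \<Delta> \<Sigma>') [x] es' Committed \<tau>'"
    and "sim \<Delta> \<tau> \<tau>'" and es: "es = map (hide_fields D) es'"
    using run_sim[OF committed.hyps(1) sim_tx_begin[OF committed.prems]] by blast
  with committed.IH[OF ledger_sim_tx_end] obtain obs' where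
    "history ord G' (tx_end G' \<Delta> \<tau>') txs obs'" "obs = map (map_prod (map (hide_fields D)) id) obs'"
    by blast
  with run es show ?case
    by (intro exI[of _ "(es', Committed) # obs'"]) (auto intro: history.committed)
next
  case (failed \<Delta> \<Sigma> x es \<tau> txs obs)
  obtain es' \<tau>' where run: "run ord G' \<Delta> (tx_begin G' \<Delta> \<Sigma>') [x] es' Failed \<tau>'"
    and es: "es = map (hide_fields D) es'"
    using run_sim[OF failed.hyps(1) sim_tx_begin[OF failed.prems]] by blast
  \<comment> \<open>A failed transaction is rolled back, auxiliary fields included, so the ledgers
    related at its start are those from which the history continues.\<close>
  from failed.IH[OF failed.prems] obtain obs' where
    "history ord G' \<Sigma>' txs obs'" "obs = map (map_prod (map (hide_fields D)) id) obs'"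
    by blast
  with run es show ?case
    by (intro exI[of _ "(es', Failed) # obs'"]) (auto intro: history.failed)
next
  case (ongoing \<Delta> \<Sigma> x es \<tau>)
  obtain es' \<tau>' where run: "run ord G' \<Delta> (tx_begin G' \<Delta> \<Sigma>') [x] es' Ongoing \<tau>'"
    and es: "es = map (hide_fields D) es'"
    using run_sim[OF ongoing.hyps(1) sim_tx_begin[OF ongoing.prems]] by blast
  then show ?case
    by (intro exI[of _ "[(es', Ongoing)]"]) (auto intro: history.ongoing)
qed

lemma history_sim_converse:
  assumes "history ord G' \<Sigma>' txs obs'" "ledger_sim \<Sigma> \<Sigma>'"
  shows "history ord G \<Sigma> txs (map (map_prod (map (hide_fields D)) id) obs')"
  using assms
proof (induction arbitrary: \<Sigma> rule: history.induct)
  case (empty \<Sigma>')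
  then show ?case by (auto intro: history.empty)
next
  case (committed \<Delta> \<Sigma>' x es \<tau>' txs obs)
  with run_sim_converse[OF committed.hyps(1) sim_tx_begin[OF committed.prems]] show ?case
    by (auto intro: history.committed dest: ledger_sim_tx_end)
next
  case (failed \<Delta> \<Sigma>' x es \<tau>' txs obs)
  with run_sim_converse[OF failed.hyps(1) sim_tx_begin[OF failed.prems]] show ?case
    by (auto intro: history.failed)
next
  case (ongoing \<Delta> \<Sigma>' x es \<tau>')
  with run_sim_converse[OF ongoing.hyps(1) sim_tx_begin[OF ongoing.prems]] show ?case
    by (auto intro: history.ongoing)
qed

lemma ledger_sim_add_fields:
  "ledger_sim \<Sigma> (add_fields (\<lambda>_. Bool False) D G \<Sigma>)"
  by (auto simp: ledger_sim_def add_fields_def option.rel_map idle_deployed intro: option.rel_refl)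

lemma history_iff:
  "history ord G \<Sigma> txs obs \<longleftrightarrow>
    (\<exists>obs'. history ord G' (add_fields (\<lambda>_. Bool False) D G \<Sigma>) txs obs' \<and>
            obs = map (map_prod (map (hide_fields D)) id) obs')"
  using history_sim history_sim_converse ledger_sim_add_fields by blast

end

text \<open>The interpreter copes with every constructor of \<open>contract\<close>; what remains to
  be checked is that its own code is written with \<open>M\<close>.\<close>

lemma (in interpreter) implements_if_range_subset:
  assumes "range tr \<subseteq> M"
  shows "implements ord M N"
  unfolding implements_def
proof (intro exI conjI allI impI ballI)
  show "tr C \<in> M" for C using assms by auto
next
  fix G :: "('a, 'p, 'c, 'b) network" and D \<Sigma> txs obs
  assume "\<forall>a\<in>D. \<exists>C\<in>N. G a = Some C"
  then interpret replacement tr idle m G D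
    by unfold_locales auto
  show "history ord G \<Sigma> txs obs \<longleftrightarrow>
    (\<exists>obs'. history ord (replace_contracts tr D G) (add_fields (\<lambda>_. Bool False) D G \<Sigma>) txs obs' \<and>
            obs = map (map_prod (map (hide_fields D)) id) obs')"
    by (rule history_iff)
qed


section \<open>Interpreters for the four mechanisms\<close>

lemma resume_deployed [simp]: "resume (Duo s (Bool False)) = s"
  by (simp add: resume_def)

text \<open>Between transactions the storage may still be packed, and \<open>resume\<close> then
  selects the saved hookup result. No memory is declared, hence \<open>None\<close>.\<close>

lemma interpreter_First:
  "interpreter (\<lambda>C. First (interpret_contract C)) (\<lambda>s u. s = resume u) None"
  by unfold_locales
    (auto simp: interpret_contract_def Let_def option.map_comp comp_def intro!: option.map_cong)

lemma interpreter_Count: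
  "interpreter (\<lambda>C. Count (\<lambda>n. interpret_contract C (n = 0))) (\<lambda>s u. s = resume u) None"
  by unfold_locales
    (auto simp: interpret_contract_def Let_def option.map_comp comp_def intro!: option.map_cong)

text \<open>The transaction memory is a one-shot flag: it starts as \<open>Bool True\<close> and
  every operation leaves \<open>Bool False\<close> behind.\<close>

lemma interpreter_Trmem:
  "interpreter
    (\<lambda>C. Trmem (\<lambda>\<Delta> s. Bool True)
      (\<lambda>w \<Delta> p u b. map_option (\<lambda>(u', ls). (u', Bool False, ls))
        (interpret_contract C (w = Bool True) \<Delta> p u b)))
    (\<lambda>s u. s = resume u) (Some (Bool False))"
  by unfold_locales
    (auto simp: interpret_contract_def Let_def option.map_comp comp_def intro!: option.map_cong)

text \<open>The hookup of the interpreter turns the saved result into the main storage and resets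
  the marker, so that each transaction finds the form that a freshly deployed contract has. This is
  why \<open>idle\<close> is an equation for \<open>u\<close> here, and why the marker alone reveals
  the first operation.\<close>

lemma interpreter_Bstore:
  "interpreter
    (\<lambda>C. Bstore (\<lambda>\<Delta> u. Duo (aux (aux u)) (Bool False))
      (\<lambda>\<Delta> p u b. interpret_contract C (aux u = Bool False) \<Delta> p u b))
    (\<lambda>s u. u = Duo s (Bool False)) None"
  by unfold_locales
    (auto simp: interpret_contract_def Let_def option.map_comp comp_def intro!: option.map_cong)

lemma implements_all:
  assumes "M \<in> {trmem_mech, first_mech, count_mech, bstore_mech :: ('a, 'p, 'c, 'b) mechanism}"
  shows "implements ord M N"
proof -
  have "implements ord trmem_mech N"
    by (rule interpreter.implements_if_range_subset[OF interpreter_Trmem])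
      (auto simp: trmem_mech_def)
  moreover have "implements ord first_mech N"
    by (rule interpreter.implements_if_range_subset[OF interpreter_First])
      (auto simp: first_mech_def)
  moreover have "implements ord count_mech N"
    by (rule interpreter.implements_if_range_subset[OF interpreter_Count])
      (auto simp: count_mech_def)
  moreover have "implements ord bstore_mech N"
    by (rule interpreter.implements_if_range_subset[OF interpreter_Bstore])
      (auto simp: bstore_mech_def)
  ultimately show ?thesis using assms by blast
qed

theorem theorem1:
  fixes ord :: order
  shows "pairwise (mech_equivalent ord)
    {trmem_mech, first_mech, count_mech, bstore_mech :: ('a, 'p, 'c, 'b) mechanism}"
  using implements_all unfolding mech_equivalent_def by (intro pairwiseI) blast

end
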